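(* For any $c=(c_1,c_2,c_3)\in\partial J_0$ with $c_3=c_3^*(c_1,c_2)$ and $c_2>0$, there exist sequences $\nu_k\to0^+$ and $c_k\in J_{\nu_k}$ with $c_k\to c$ such that for any $\epsilon>0$, $$\inf_k\left\|\tfrac12\left(U^+_{\nu_k,\theta}(c_k)\right)^2-P_{c_k}\right\|_{L^\infty(1-\epsilon,1)}>0.$$ Similarly, for any $c\in\partial J_0$ with $c_3=c_3^*(c_1,c_2)$ and $c_1>0$, there exist sequences $\nu_k\to0^+$ and $c_k\in J_{\nu_k}$ with $c_k\to c$ such that for any $\epsilon>0$, $$\inf_k\left\|\tfrac12\left(U^-_{\nu_k,\theta}(c_k)\right)^2-P_{c_k}\right\|_{L^\infty(-1,-1+\epsilon)}>0.$$
   Context: For $c=(c_1,c_2,c_3)\in\mathbb{R}^3$ let $P_c(x)=c_1(1-x)+c_2(1+x)+c_3(1-x^2)$. For $\nu\ge0$ let $$\bar c_3(c_1,c_2;\nu)=-\tfrac12\left(\sqrt{\nu^2+c_1}+\sqrt{\nu^2+c_2}\right)\left(\sqrt{\nu^2+c_1}+\sqrt{\nu^2+c_2}+2\nu\right),$$ $$J_\nu=\{c\in\mathbb{R}^3: c_1\ge-\nu^2,\ c_2\ge-\nu^2,\ c_3\ge\bar c_3(c_1,c_2;\nu)\}.$$ For $c_1,c_2\ge0$, $c_3^*(c_1,c_2)=\bar c_3(c_1,c_2;0)=-\frac12(c_1+2\sqrt{c_1c_2}+c_2)$. For $\nu>0$ and $c\in J_\nu$, consider the differential equation $$\nu(1-x^2)U'+2\nu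 xU+\tfrac12U^2=P_c(x),\qquad -1<x<1.$$ It is known that among its $C^1(-1,1)$ solutions there are a greatest one $U^+_{\nu,\theta}(c)$ (upper solution) and a least one $U^-_{\nu,\theta}(c)$ (lower solution), i.e. $U^-_{\nu,\theta}(c)\le U\le U^+_{\nu,\theta}(c)$ on $(-1,1)$ for every solution $U$; solutions extend continuously to $[-1,1]$. *)

theory Defs
  imports "HOL-Analysis.Analysis" "HOL-Probability.Essential_Supremum"
begin

definition Pc :: "real^3 \<Rightarrow> real \<Rightarrow> real" where
  "Pc c x = c$1 * (1 - x) + c$2 * (1 + x) + c$3 * (1 - x^2)"

definition c3_bar :: "real \<Rightarrow> real \<Rightarrow> real \<Rightarrow> real" where
  "c3_bar c1 c2 \<nu> =
     - (1/2) * (sqrt (\<nu>^2 + c1) + sqrt (\<nu>^2 + c2))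
             * (sqrt (\<nu>^2 + c1) + sqrt (\<nu>^2 + c2) + 2 * \<nu>)"

definition Jset :: "real \<Rightarrow> (real^3) set" where
  "Jset \<nu> = {c. c$1 \<ge> - (\<nu>^2) \<and> c$2 \<ge> - (\<nu>^2) \<and> c$3 \<ge> c3_bar (c$1) (c$2) \<nu>}"

definition c3_star :: "real \<Rightarrow> real \<Rightarrow> real" where
  "c3_star c1 c2 = c3_bar c1 c2 0"

lemma c3_star_eq:
  assumes "c1 \<ge> 0" "c2 \<ge> 0"
  shows "c3_star c1 c2 = - (1/2) * (c1 + 2 * sqrt (c1 * c2) + c2)"
proof -
  have "sqrt c1 * sqrt c1 = c1" "sqrt c2 * sqrt c2 = c2" using assms by auto
  then show ?thesis
    by (simp add: c3_star_def c3_bar_def real_sqrt_mult algebra_simps)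
qed

definition ode_solution :: "real \<Rightarrow> real^3 \<Rightarrow> (real \<Rightarrow> real) \<Rightarrow> bool" where
  "ode_solution \<nu> c U \<longleftrightarrow>
     U C1_differentiable_on {-1<..<1} \<and>
     (\<forall>x\<in>{-1<..<1}. \<nu> * (1 - x^2) * deriv U x + 2 * \<nu> * x * U x + (1/2) * (U x)^2 = Pc c x)"

text \<open>The values of a solution outside \<open>(-1, 1)\<close> are irrelevant, so the greatest and the
  least solution are unique only as functions on \<open>(-1, 1)\<close>; they are
  therefore rendered as predicates rather than by a choice of representative.\<close>

definition upper_solution :: "real \<Rightarrow> real^3 \<Rightarrow> (real \<Rightarrow> real) \<Rightarrow> bool" where
  "upper_solution \<nu> c U \<longleftrightarrow>
     ode_solution \<nu> c U \<and> (\<forall>V. ode_solution \<nu> c V \<longrightarrow> (\<forall>x\<in>{-1<..<1}. V x \<le> U x))"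

definition lower_solution :: "real \<Rightarrow> real^3 \<Rightarrow> (real \<Rightarrow> real) \<Rightarrow> bool" where
  "lower_solution \<nu> c U \<longleftrightarrow>
     ode_solution \<nu> c U \<and> (\<forall>V. ode_solution \<nu> c V \<longrightarrow> (\<forall>x\<in>{-1<..<1}. U x \<le> V x))"

text \<open>The set is intersected with \<open>(-1, 1)\<close>, the domain of the functions under
  consideration; this matters only for intervals \<open>(1-\<epsilon>, 1)\<close> or
  \<open>(-1, -1+\<epsilon>)\<close> with \<open>\<epsilon> > 2\<close>.\<close>

definition Linf_norm :: "real set \<Rightarrow> (real \<Rightarrow> real) \<Rightarrow> ereal" where
  "Linf_norm S f = esssup (lebesgue_on (S \<inter> {-1<..<1})) (\<lambda>x. ereal \<bar>f x\<bar>)"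

end

theory Submission
  imports Defs
begin

text \<open>
  When \<open>c$3\<close> equals \<open>c3_bar (c$1) (c$2) \<nu>\<close>, the smallest value permitted in \<open>Jset \<nu>\<close>, the
  equation has an affine solution, which is negative near \<open>x = 1\<close>. As soon as \<open>c$3\<close> is
  larger, the upper solution must end at \<open>-2\<nu> + 2 sqrt (\<nu>\<^sup>2 + c$2)\<close>, which is positive for \<open>c$2 > 0\<close>; if \<open>c$3\<close>
  exceeds the critical value only by a very small amount, the upper solution still follows the affine
  one up to a point close to \<open>1\<close> and turns positive only behind it. So it vanishes at some point
  \<open>y\<close> close to \<open>1\<close>, where the residual \<open>U\<^sup>2/2 - P\<close> is \<open>-P(y)\<close>, approximately \<open>-2 c$2\<close>. Taking
  \<open>c$1\<close> and \<open>c$2\<close> fixed, \<open>\<nu> = 1/(k+1)\<close>, and the excess in \<open>c$3\<close> small enough for the zero \<open>y\<close> to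
  lie in \<open>(1 - \<nu>, 1)\<close>, one gets the required sequences.

  These solutions are available in closed form. With \<open>z = (1 + x)/2\<close>, the substitution
  \<open>U = 4\<nu> z(1 - z) w'/w\<close> turns the Riccati equation into a linear equation of second order with three
  regular singular points, and \<open>w = z\<^sup>b (1 - z)\<^sup>a F\<close> reduces it to the
  hypergeometric equation for \<open>F\<close>. Here \<open>F = 1\<close> is the affine solution at the critical \<open>c$3\<close>, and an
  excess \<open>2\<nu>\<^sup>2 l\<close> in \<open>c$3\<close> is the hypergeometric parameter \<open>l\<close>. For \<open>l > 0\<close> all Taylor
  coefficients of \<open>F\<close> are positive. This makes \<open>w\<close> positive, so that \<open>U\<close> is defined on all of
  \<open>(-1, 1)\<close>; at a fixed \<open>z\<close> one has \<open>F' = O(l)\<close> (\<open>hyp_d1_le_linear\<close>), so that \<open>U\<close> stays negative there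
  for small \<open>l\<close>; and yet for every \<open>l > 0\<close> the derivative \<open>F'/F\<close> is large near \<open>z = 1\<close>
  (\<open>hyp_log_derivative_large\<close>), which forces the change of sign.

  That this \<open>U\<close> is the greatest solution follows from its behaviour near \<open>x = -1\<close>: if another
  solution \<open>V\<close> were larger somewhere, \<open>1/(V - U)\<close> would be positive on the left of that point and
  yet tend to \<open>-\<infinity>\<close> (\<open>upper_solutionI\<close>).

  For a given \<open>\<epsilon>\<close>, the zero \<open>y\<close> lies in \<open>(1 - \<epsilon>, 1)\<close> for all but finitely many \<open>k\<close>. For the others
  it is enough that the residual is not identically zero near \<open>1\<close>
  (\<open>ode_solution_residual_nonzero\<close>). The statement on lower solutions is the mirror image under
  \<open>U(x) \<mapsto> -U(-x)\<close>, which exchanges \<open>c$1\<close> and \<open>c$2\<close>.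
\<close>

section \<open>Comparison of solutions\<close>

lemma one_minus_square_pos:
  fixes x :: real
  assumes "-1 < x" "x < 1"
  shows "1 - x\<^sup>2 > 0"
  using assms by (simp add: abs_square_less_1[of x] abs_less_iff)

text \<open>
  The factor \<open>\<nu> (1 - x\<^sup>2)\<close> is positive on \<open>(-1, 1)\<close>, so the equation can be solved for the derivative; the
  resulting formula also shows that the derivative of a differentiable solution is continuous.
\<close>

lemma ode_solution_iff:
  assumes "\<nu> > 0"
  shows "ode_solution \<nu> c U \<longleftrightarrow> (\<forall>x\<in>{-1<..<1}.
    (U has_real_derivative (Pc c x - 2 * \<nu> * x * U x - (U x)\<^sup>2 / 2) / (\<nu> * (1 - x\<^sup>2))) (at x))"
    (is "_ \<longleftrightarrow> (\<forall>x\<in>?I. (U has_real_derivative ?D x) (at x))")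
proof -
  have pos: "\<nu> * (1 - x\<^sup>2) > 0" if "x \<in> ?I" for x
    using that assms one_minus_square_pos by simp
  have nz: "\<nu> * (1 - x\<^sup>2) \<noteq> 0" if "x \<in> ?I" for x
    using pos[OF that] by (rule less_imp_neq[THEN not_sym])
  show ?thesis
  proof
    assume sol: "ode_solution \<nu> c U"
    show "\<forall>x\<in>?I. (U has_real_derivative ?D x) (at x)"
    proof
      fix x assume x: "x \<in> ?I"
      from sol x have "U differentiable at x"
        unfolding ode_solution_def C1_differentiable_on_eq by blast
      then have "(U has_real_derivative deriv U x) (at x)"
        by (simp add: DERIV_deriv_iff_real_differentiable)
      moreover have "\<nu> * (1 - x\<^sup>2) * deriv U x = Pc c x - 2 * \<nu> * x * U x - (U x)\<^sup>2 / 2"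
        using sol x unfolding ode_solution_def by (auto simp: algebra_simps)
      then have "deriv U x = ?D x"
        using pos[OF x] by (metis less_irrefl nonzero_mult_div_cancel_left)
      ultimately show "(U has_real_derivative ?D x) (at x)" by simp
    qed
  next
    assume der: "\<forall>x\<in>?I. (U has_real_derivative ?D x) (at x)"
    have contU: "continuous_on ?I U"
      by (rule DERIV_continuous_on[where D = ?D], rule has_field_derivative_at_within, erule bspec[OF der])
    have "continuous_on ?I ?D"
      unfolding Pc_def by (intro continuous_intros contU) ((rule ballI, erule nz) | simp)+
    then have "U C1_differentiable_on ?I"
      unfolding C1_differentiable_on_def
      using der by (auto simp: has_real_derivative_iff_has_vector_derivative)
    moreover have "\<nu> * (1 - x\<^sup>2) * deriv U x + 2 * \<nu> * x * U x + 1/2 * (U x)\<^sup>2 = Pc c x"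
      if x: "x \<in> ?I" for x
    proof -
      have "deriv U x = ?D x" using der x DERIV_imp_deriv by blast
      then have "\<nu> * (1 - x\<^sup>2) * deriv U x = Pc c x - 2 * \<nu> * x * U x - (U x)\<^sup>2 / 2"
        using nz[OF x] by (metis nonzero_mult_div_cancel_left times_divide_eq_right)
      then show ?thesis by (simp add: algebra_simps)
    qed
    ultimately show "ode_solution \<nu> c U"
      unfolding ode_solution_def by blast
  qed
qed

lemma ode_solution_continuous_on:
  "ode_solution \<nu> c U \<Longrightarrow> continuous_on {-1<..<1} U"
  unfolding ode_solution_def by (simp add: C1_differentiable_imp_continuous_on)

text \<open>
  \<open>D\<close> times the integrating factor \<open>exp (- \<integral> r)\<close> is constant, so \<open>D\<close> cannot change sign.
\<close>

lemma linear_ode_preserves_sign: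
  fixes D r :: "real \<Rightarrow> real"
  assumes "a \<le> b" "continuous_on {a..b} r"
    and der: "\<And>x. x \<in> {a..b} \<Longrightarrow> (D has_real_derivative r x * D x) (at x)"
    and "D b > 0"
  shows "D a > 0"
proof -
  obtain R where R: "\<And>x. x \<in> {a..b} \<Longrightarrow> (R has_real_derivative r x) (at x within {a..b})"
    using antiderivative_continuous[OF assms(2)]
    by (metis has_real_derivative_iff_has_vector_derivative)
  have "((\<lambda>x. D x * exp (- R x)) has_real_derivative 0) (at x within {a..b})"
    if "x \<in> {a..b}" for x
    by (rule derivative_eq_intros R[OF that] has_field_derivative_at_within[OF der[OF that]] refl)+
      (simp add: algebra_simps)
  then obtain k where "\<And>x. x \<in> {a..b} \<Longrightarrow> D x * exp (- R x) = k"
    using has_field_derivative_zero_constant[of "{a..b}" "\<lambda>x. D x * exp (- R x)"] by auto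
  then have "D a * exp (- R a) = D b * exp (- R b)"
    using \<open>a \<le> b\<close> by simp
  also have "\<dots> > 0" using \<open>D b > 0\<close> by simp
  finally show ?thesis by (simp add: zero_less_mult_iff)
qed

text \<open>
  If \<open>V\<close> is another solution and \<open>D = V - U\<close> is positive at one point, then \<open>D\<close> solves a linear
  equation, hence is positive everywhere, and \<open>1/D\<close> satisfies
  \<open>(1/D)' = (2\<nu>x + U) / (\<nu>(1 - x\<^sup>2)) \<cdot> 1/D + 1 / (2\<nu>(1 - x\<^sup>2))\<close>.
  Where \<open>U \<ge> -2\<nu>x\<close> the first term is nonnegative, and the second is at least the derivative of
  \<open>ln (1 + x) / (4\<nu>)\<close>. Integrating towards \<open>-1\<close>, where the logarithm diverges, \<open>1/D\<close> would
  become negative.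
\<close>

lemma upper_solutionI:
  assumes nu: "\<nu> > 0" and U: "ode_solution \<nu> c U"
    and y: "y > -1" "\<And>x. -1 < x \<Longrightarrow> x \<le> y \<Longrightarrow> U x \<ge> - 2 * \<nu> * x"
  shows "upper_solution \<nu> c U"
  unfolding upper_solution_def
proof (intro conjI allI impI ballI U)
  fix V x0 assume V: "ode_solution \<nu> c V" and x0: "x0 \<in> {-1<..<1::real}"
  note dU = U[unfolded ode_solution_iff[OF nu], rule_format]
    and dV = V[unfolded ode_solution_iff[OF nu], rule_format]
  have pos: "\<nu> * (1 - x\<^sup>2) > 0" if "x \<in> {-1<..<1}" for x :: real
    using that nu one_minus_square_pos by simp
  have nz: "\<nu> * (1 - x\<^sup>2) \<noteq> 0" if "x \<in> {-1<..<1}" for x :: real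
    using pos[OF that] by (rule less_imp_neq[THEN not_sym])
  show "V x0 \<le> U x0"
  proof (rule ccontr)
    assume "\<not> V x0 \<le> U x0"
    define D where "D x = V x - U x" for x
    define r where "r x = - (2 * \<nu> * x + (U x + V x) / 2) / (\<nu> * (1 - x\<^sup>2))" for x
    have D0: "D x0 > 0" using \<open>\<not> V x0 \<le> U x0\<close> by (simp add: D_def)
    have dD: "(D has_real_derivative r x * D x) (at x)" if "x \<in> {-1<..<1}" for x
    proof -
      have "(Pc c x - 2 * \<nu> * x * V x - (V x)\<^sup>2 / 2) - (Pc c x - 2 * \<nu> * x * U x - (U x)\<^sup>2 / 2)
          = - (2 * \<nu> * x + (U x + V x) / 2) * D x"
        by (simp add: D_def field_simps power2_eq_square)
      then show ?thesis
        using DERIV_diff[OF dV[OF that] dU[OF that]]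
        unfolding D_def r_def by (simp only: flip: diff_divide_distrib) (simp only: times_divide_eq_left)
    qed
    have contr: "continuous_on {-1<..<1} r"
      unfolding r_def
      by (intro continuous_intros ode_solution_continuous_on[OF U] ode_solution_continuous_on[OF V])
        ((rule ballI, erule nz) | simp)+
    have Dpos: "D x > 0" if "-1 < x" "x \<le> x0" for x
      using that x0 D0
      by (intro linear_ode_preserves_sign[of x x0 r D] dD continuous_on_subset[OF contr]) auto
    define y1 where "y1 = min y x0"
    have y1: "-1 < y1" "y1 \<le> y" "y1 \<le> x0" "y1 < 1" using y x0 by (auto simp: y1_def)
    define E where "E x = 1 / D x - ln (1 + x) / (4 * \<nu>)" for x
    have dE: "\<exists>e. (E has_real_derivative e) (at x) \<and> 0 \<le> e" if "-1 < x" "x \<le> y1" for x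
    proof -
      have x: "x \<in> {-1<..<1}" using that y1 by auto
      have Dx: "D x > 0" using Dpos that y1 by auto
      have "(E has_real_derivative - (r x * D x) / (D x)\<^sup>2 - 1 / ((1 + x) * (4 * \<nu>))) (at x)"
        unfolding E_def
      proof (rule DERIV_diff)
        show "((\<lambda>x. 1 / D x) has_real_derivative - (r x * D x) / (D x)\<^sup>2) (at x)"
          using Dx by (auto intro!: derivative_eq_intros dD[OF x] simp: power2_eq_square)
        show "((\<lambda>x. ln (1 + x) / (4 * \<nu>)) has_real_derivative 1 / ((1 + x) * (4 * \<nu>))) (at x)"
          using that nu by (auto intro!: derivative_eq_intros)
      qed
      moreover have "- (r x * D x) / (D x)\<^sup>2 \<ge> 1 / ((1 + x) * (4 * \<nu>))"
      proof -
        have "- (r x * D x) / (D x)\<^sup>2 = - r x / D x"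
          using Dx by (simp add: power2_eq_square)
        also have "\<dots> = (2 * \<nu> * x + U x) / (\<nu> * (1 - x\<^sup>2) * D x) + 1 / (2 * (\<nu> * (1 - x\<^sup>2)))"
        proof -
          have "- r x = (2 * \<nu> * x + U x + D x / 2) / (\<nu> * (1 - x\<^sup>2))"
            unfolding r_def minus_divide_left by (simp add: D_def field_simps)
          moreover have "(u + d / 2) / q / d = u / (q * d) + 1 / (2 * q)"
            if "d > 0" "q > 0" for u d q :: real
            using that by (simp add: field_simps)
          ultimately show ?thesis using Dx pos[OF x] by simp
        qed
        also have "\<dots> \<ge> 0 + 1 / ((1 + x) * (4 * \<nu>))"
        proof (rule add_mono)
          have "2 * \<nu> * x + U x \<ge> 0" using y(2)[of x] that y1 by simp
          then show "0 \<le> (2 * \<nu> * x + U x) / (\<nu> * (1 - x\<^sup>2) * D x)"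
            using Dx pos[OF x] by simp
          have "2 * (\<nu> * (1 - x\<^sup>2)) = (2 * \<nu>) * (1 + x) * (1 - x)"
            by (simp add: power2_eq_square algebra_simps)
          also have "\<dots> \<le> (2 * \<nu>) * (1 + x) * 2"
            using that nu by (intro mult_left_mono) auto
          also have "\<dots> = (1 + x) * (4 * \<nu>)" by simp
          finally have le: "2 * (\<nu> * (1 - x\<^sup>2)) \<le> (1 + x) * (4 * \<nu>)" .
          show "1 / ((1 + x) * (4 * \<nu>)) \<le> 1 / (2 * (\<nu> * (1 - x\<^sup>2)))"
            by (rule frac_le[OF zero_le_one order_refl _ le]) (use pos[OF x] in linarith)
        qed
        finally show ?thesis by simp
      qed
      ultimately show ?thesis by force
    qed
    \<comment> \<open>At this point the logarithm has exhausted the value of \<open>1 / (V - U)\<close> at \<open>y1\<close>.\<close>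
    define x where "x = -1 + (1 + y1) * exp (- (4 * \<nu> / D y1))"
    have Dy1: "D y1 > 0" using Dpos y1 by auto
    have x: "-1 < x" "x \<le> y1"
    proof -
      have "exp (- (4 * \<nu> / D y1)) \<le> 1" using Dy1 nu by simp
      then have "(1 + y1) * exp (- (4 * \<nu> / D y1)) \<le> 1 + y1"
        using y1 by (simp add: mult_left_le)
      then show "x \<le> y1" by (simp add: x_def)
    qed (use y1 in \<open>simp add: x_def\<close>)
    have "E x \<le> E y1"
      by (rule DERIV_nonneg_imp_nondecreasing[OF x(2)], rule dE) (use x in linarith)+
    moreover have "ln (1 + x) = ln (1 + y1) - 4 * \<nu> / D y1"
      using y1 by (simp add: x_def ln_mult)
    then have "E x = 1 / D x + E y1"
      using nu by (simp add: E_def diff_divide_distrib)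
    ultimately have "1 / D x \<le> 0" by simp
    with Dpos[of x] x y1 show False by (simp add: divide_le_0_iff)
  qed
qed

section \<open>Reflection in the origin\<close>

definition swap12 :: "real^3 \<Rightarrow> real^3" where
  "swap12 c = vector [c$2, c$1, c$3]"

lemma swap12_nth [simp]: "swap12 c $ 1 = c$2" "swap12 c $ 2 = c$1" "swap12 c $ 3 = c$3"
  by (simp_all add: swap12_def)

lemma swap12_swap12 [simp]: "swap12 (swap12 c) = c"
  by (simp add: vec_eq_iff forall_3)

lemma Pc_swap12: "Pc (swap12 c) x = Pc c (- x)"
  by (simp add: Pc_def algebra_simps)

lemma ode_solution_reflect:
  assumes nu: "\<nu> > 0" and U: "ode_solution \<nu> c U"
  shows "ode_solution \<nu> (swap12 c) (\<lambda>x. - U (- x))"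
  unfolding ode_solution_iff[OF nu]
proof
  fix x :: real assume x: "x \<in> {-1<..<1}"
  then have "- x \<in> {-1<..<1}" by auto
  from U[unfolded ode_solution_iff[OF nu], rule_format, OF this]
  have "(U has_real_derivative (Pc c (- x) - 2 * \<nu> * (- x) * U (- x) - (U (- x))\<^sup>2 / 2) / (\<nu> * (1 - (- x)\<^sup>2))) (at (- x))"
    .
  then have "((\<lambda>x. U (- x)) has_real_derivative - ((Pc c (- x) - 2 * \<nu> * (- x) * U (- x) - (U (- x))\<^sup>2 / 2) / (\<nu> * (1 - (- x)\<^sup>2)))) (at x)"
    by (simp add: DERIV_mirror)
  from DERIV_minus[OF this]
  show "((\<lambda>x. - U (- x)) has_real_derivative
      (Pc (swap12 c) x - 2 * \<nu> * x * (- U (- x)) - (- U (- x))\<^sup>2 / 2) / (\<nu> * (1 - x\<^sup>2))) (at x)"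
    by (simp add: Pc_swap12)
qed

lemma lower_solution_reflect:
  assumes nu: "\<nu> > 0" and U: "upper_solution \<nu> c U"
  shows "lower_solution \<nu> (swap12 c) (\<lambda>x. - U (- x))"
  unfolding lower_solution_def
proof (intro conjI allI impI ballI)
  show "ode_solution \<nu> (swap12 c) (\<lambda>x. - U (- x))"
    using U ode_solution_reflect[OF nu] by (simp add: upper_solution_def)
  fix V and x :: real assume V: "ode_solution \<nu> (swap12 c) V" and x: "x \<in> {-1<..<1}"
  from ode_solution_reflect[OF nu V] have "ode_solution \<nu> c (\<lambda>x. - V (- x))" by simp
  with U x have "- V (- (- x)) \<le> U (- x)"
    unfolding upper_solution_def by (metis (no_types, lifting) greaterThanLessThan_iff minus_less_iff minus_minus)
  then show "- U (- x) \<le> V x" by simp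
qed

text \<open>
  If the essential supremum were below \<open>m < \<bar>f x0\<bar>\<close>, the set \<open>{x \<in> S. m < \<bar>f x\<bar>}\<close> would be negligible; by
  continuity it is open around \<open>x0\<close>.
\<close>

section \<open>Lower bounds for the residual\<close>

lemma Linf_norm_ge:
  assumes "open S" "x0 \<in> S \<inter> {-1<..<1}" "continuous_on {-1<..<1} f"
  shows "Linf_norm S f \<ge> ereal \<bar>f x0\<bar>"
proof (rule ccontr)
  define T where "T = S \<inter> {-1<..<1::real}"
  assume "\<not> ?thesis"
  then have "Linf_norm S f < ereal \<bar>f x0\<bar>" by (rule not_le_imp_less)
  from ereal_dense2[OF this] obtain m
    where m: "Linf_norm S f < ereal m" "ereal m < ereal \<bar>f x0\<bar>" by blast
  have T: "open T" using assms by (auto simp: T_def)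
  define A where "A = {x \<in> T. m < \<bar>f x\<bar>}"
  have "continuous_on T (\<lambda>x. \<bar>f x\<bar>)"
    using assms(3) by (intro continuous_intros) (auto simp: T_def elim: continuous_on_subset)
  then have "open (T \<inter> (\<lambda>x. \<bar>f x\<bar>) -` {m<..})"
    using T by (rule continuous_open_preimage) simp
  also have "T \<inter> (\<lambda>x. \<bar>f x\<bar>) -` {m<..} = A" by (auto simp: A_def)
  finally have "open A" .
  moreover have "x0 \<in> A" using m assms(2) by (auto simp: A_def T_def)
  ultimately have "\<not> negligible A"
    using open_not_negligible by blast
  moreover have "AE x in lebesgue_on T. ereal \<bar>f x\<bar> \<le> Linf_norm S f"
    unfolding Linf_norm_def T_def by (rule esssup_AE)
  then have "AE x in lebesgue_on T. x \<notin> A"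
  proof (rule eventually_mono)
    fix x assume "ereal \<bar>f x\<bar> \<le> Linf_norm S f"
    then have "ereal \<bar>f x\<bar> < ereal m" using m(1) by (rule order_le_less_trans)
    then show "x \<notin> A" by (simp add: A_def)
  qed
  then have "AE x in lebesgue. x \<in> T \<longrightarrow> x \<notin> A"
    using T by (subst (asm) AE_restrict_space_iff) auto
  then have "AE x in lebesgue. x \<notin> A" by (auto simp: A_def)
  then have "A \<in> null_sets lebesgue"
    using \<open>open A\<close> by (subst (asm) AE_iff_null_sets[symmetric]) auto
  then have "negligible A" by (simp add: negligible_iff_null_sets)
  ultimately show False by blast
qed

text \<open>
  If \<open>U\<^sup>2/2 = P\<close> on an interval, the equation there reduces to \<open>(1 - x\<^sup>2) U' + 2xU = 0\<close>, that is
  \<open>U = K(1 - x\<^sup>2)\<close>. Then \<open>P = U\<^sup>2/2\<close> would tend to \<open>0\<close> at \<open>x = 1\<close>, where its value is \<open>2 c$2\<close>.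
\<close>

lemma ode_solution_residual_nonzero:
  assumes nu: "\<nu> > 0" and U: "ode_solution \<nu> c U" and c2: "c$2 \<noteq> 0" and eps: "\<epsilon> > 0"
  shows "\<exists>x\<in>{1-\<epsilon><..<1} \<inter> {-1<..<1}. 1/2 * (U x)\<^sup>2 - Pc c x \<noteq> 0"
proof (rule ccontr)
  define l where "l = max (1 - \<epsilon>) (-1)"
  have l: "-1 \<le> l" "1 - \<epsilon> \<le> l" "l < 1" using eps by (auto simp: l_def)
  assume no: "\<not> ?thesis"
  have eq: "(U x)\<^sup>2 / 2 = Pc c x" if "x \<in> {l<..<1}" for x
  proof -
    have "x \<in> {1-\<epsilon><..<1} \<inter> {-1<..<1}" using that l by auto
    with no have "\<not> (1/2 * (U x)\<^sup>2 - Pc c x \<noteq> 0)" by blast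
    then show ?thesis by simp
  qed
  have "((\<lambda>x. U x / (1 - x\<^sup>2)) has_real_derivative 0) (at x)" if x: "x \<in> {l<..<1}" for x
  proof -
    have "1 - x\<^sup>2 > 0" using x l by (intro one_minus_square_pos) auto
    moreover have "(U has_real_derivative (Pc c x - 2 * \<nu> * x * U x - (U x)\<^sup>2 / 2) / (\<nu> * (1 - x\<^sup>2))) (at x)"
      using U x l unfolding ode_solution_iff[OF nu] by auto
    then have "(U has_real_derivative - (2 * x * U x) / (1 - x\<^sup>2)) (at x)"
      using eq[OF x] nu by (simp add: mult.assoc)
    ultimately show ?thesis
      by (intro derivative_eq_intros | simp)+
  qed
  then have "\<exists>K. \<forall>x\<in>{l<..<1}. U x / (1 - x\<^sup>2) = K"
    by (intro has_field_derivative_zero_constant) (auto intro: has_field_derivative_at_within)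
  then obtain K where K: "\<And>x. x \<in> {l<..<1} \<Longrightarrow> U x / (1 - x\<^sup>2) = K" by blast
  have "K\<^sup>2 * (1 - x\<^sup>2)\<^sup>2 / 2 = Pc c x" if x: "x \<in> {l<..<1}" for x
  proof -
    have "1 - x\<^sup>2 > 0" using x l by (intro one_minus_square_pos) auto
    then have "U x = K * (1 - x\<^sup>2)" using K[OF x] by (simp add: field_simps)
    then show ?thesis using eq[OF x] by (simp add: power_mult_distrib)
  qed
  then have "eventually (\<lambda>x. K\<^sup>2 * (1 - x\<^sup>2)\<^sup>2 / 2 = Pc c x) (at_left 1)"
    using eventually_at_left[OF l(3)] l(3) by (auto simp: eventually_at_left_field)
  moreover have "((\<lambda>x. K\<^sup>2 * (1 - x\<^sup>2)\<^sup>2 / 2) \<longlongrightarrow> K\<^sup>2 * (1 - 1\<^sup>2)\<^sup>2 / 2) (at_left 1)"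
    by (intro tendsto_intros) auto
  ultimately have "(Pc c \<longlongrightarrow> 0) (at_left 1)"
    using tendsto_cong by fastforce
  moreover have "(Pc c \<longlongrightarrow> Pc c 1) (at_left 1)"
    unfolding Pc_def by (intro tendsto_intros)
  ultimately have "Pc c 1 = 0"
    using tendsto_unique by (metis trivial_limit_at_left_real)
  with c2 show False by (simp add: Pc_def)
qed

section \<open>A hypergeometric series with positive coefficients\<close>

text \<open>
  The Taylor coefficients of the hypergeometric function \<open>F(A, B; C; z)\<close> with \<open>A + B = D\<close> and
  \<open>A B = l\<close>, since then \<open>(n + A)(n + B) = n(n + D) + l\<close>. Using the sum and the product of
  \<open>A\<close> and \<open>B\<close> as parameters lets \<open>l\<close> vary while \<open>D\<close>, which is determined by the exponents at \<open>z = 0\<close>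
  and \<open>z = 1\<close>, stays fixed.
\<close>

primrec hyp_coeff :: "real \<Rightarrow> real \<Rightarrow> real \<Rightarrow> nat \<Rightarrow> real" where
  "hyp_coeff C D l 0 = 1"
| "hyp_coeff C D l (Suc n) =
     (real n * (real n + D) + l) / ((real n + 1) * (real n + C)) * hyp_coeff C D l n"

definition hyp :: "real \<Rightarrow> real \<Rightarrow> real \<Rightarrow> real \<Rightarrow> real" where
  "hyp C D l z = (\<Sum>n. hyp_coeff C D l n * z ^ n)"

definition hyp_d1 :: "real \<Rightarrow> real \<Rightarrow> real \<Rightarrow> real \<Rightarrow> real" where
  "hyp_d1 C D l z = (\<Sum>n. diffs (hyp_coeff C D l) n * z ^ n)"

definition hyp_d2 :: "real \<Rightarrow> real \<Rightarrow> real \<Rightarrow> real \<Rightarrow> real" where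
  "hyp_d2 C D l z = (\<Sum>n. diffs (diffs (hyp_coeff C D l)) n * z ^ n)"

lemma hyp_coeff_pos:
  assumes "C > 0" "D \<ge> 0" "l > 0"
  shows "hyp_coeff C D l n > 0"
proof (induction n)
  case (Suc n)
  have "real n * (real n + D) + l > 0"
    using assms by (intro add_nonneg_pos) auto
  with Suc assms show ?case by (simp add: add_nonneg_pos)
qed simp

lemma summable_hyp_coeff:
  assumes "C > 0" "D \<ge> 0" "l > 0" "norm z < 1"
  shows "summable (\<lambda>n. hyp_coeff C D l n * z ^ n)"
proof -
  define r where "r = (1 + \<bar>z\<bar>) / 2"
  have r: "\<bar>z\<bar> < r" "r < 1" using assms(4) by (auto simp: r_def)
  have "(\<lambda>n. \<bar>z\<bar> * (1 + (D + l) / real n)) \<longlonglongrightarrow> \<bar>z\<bar> * (1 + 0)"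
    by (intro tendsto_intros lim_const_over_n)
  with r have "eventually (\<lambda>n. \<bar>z\<bar> * (1 + (D + l) / real n) < r) sequentially"
    by (intro order_tendstoD(2)) auto
  then obtain N where N: "\<And>n. n \<ge> N \<Longrightarrow> \<bar>z\<bar> * (1 + (D + l) / real n) < r"
    by (auto simp: eventually_sequentially)
  show ?thesis
  proof (rule summable_ratio_test[OF r(2)])
    fix n assume n: "n \<ge> max N 1"
    define h where "h = hyp_coeff C D l n"
    define k where "k = (real n * (real n + D) + l) / ((real n + 1) * (real n + C))"
    have h: "h > 0" unfolding h_def by (rule hyp_coeff_pos[OF assms(1-3)])
    have n1: "real n \<ge> 1" using n by simp
    have k0: "k \<ge> 0" unfolding k_def using assms by auto
    have "k \<le> (real n * (real n + D + l)) / (real n * real n)"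
      unfolding k_def
    proof (rule frac_le)
      have "1 * l \<le> real n * l" using n1 assms by (intro mult_right_mono) auto
      then show "real n * (real n + D) + l \<le> real n * (real n + D + l)"
        by (simp add: algebra_simps)
      show "real n * real n \<le> (real n + 1) * (real n + C)"
        using assms by (intro mult_mono) auto
    qed (use n1 assms in auto)
    also have "\<dots> = 1 + (D + l) / real n"
      using n1 by (simp add: field_simps)
    finally have "\<bar>z\<bar> * k \<le> \<bar>z\<bar> * (1 + (D + l) / real n)"
      by (intro mult_left_mono) auto
    with N[of n] n have zk: "\<bar>z\<bar> * k \<le> r" by auto
    have "norm (hyp_coeff C D l (Suc n) * z ^ Suc n) = (\<bar>z\<bar> * k) * (h * \<bar>z\<bar> ^ n)"
      using h k0 by (simp add: h_def[symmetric] k_def[symmetric] abs_mult power_abs)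
    also have "\<dots> \<le> r * (h * \<bar>z\<bar> ^ n)"
      using zk h by (intro mult_right_mono) auto
    also have "\<dots> = r * norm (hyp_coeff C D l n * z ^ n)"
      using h by (simp add: h_def[symmetric] abs_mult power_abs)
    finally show "norm (hyp_coeff C D l (Suc n) * z ^ Suc n) \<le> r * norm (hyp_coeff C D l n * z ^ n)" .
  qed
qed

lemma summable_diffs_hyp_coeff:
  assumes "C > 0" "D \<ge> 0" "l > 0" "norm z < 1"
  shows "summable (\<lambda>n. diffs (hyp_coeff C D l) n * z ^ n)"
  by (rule termdiff_converges[OF assms(4) summable_hyp_coeff[OF assms(1-3)]])

lemma hyp_has_derivative:
  assumes "C > 0" "D \<ge> 0" "l > 0" "norm z < 1"
  shows "(hyp C D l has_real_derivative hyp_d1 C D l z) (at z)"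
  using termdiffs_strong'[OF summable_hyp_coeff[OF assms(1-3)] assms(4)]
  unfolding hyp_def[abs_def] hyp_d1_def by simp

lemma hyp_d1_has_derivative:
  assumes "C > 0" "D \<ge> 0" "l > 0" "norm z < 1"
  shows "(hyp_d1 C D l has_real_derivative hyp_d2 C D l z) (at z)"
  using termdiffs_strong'[OF summable_diffs_hyp_coeff[OF assms(1-3)] assms(4)]
  unfolding hyp_d1_def[abs_def] hyp_d2_def by simp

text \<open>
  The coefficient of \<open>z\<^sup>n\<close> in this equation is \<open>(n + 1)(n + C) h\<^sub>n\<^sub>+\<^sub>1 = (n(n + D) + l) h\<^sub>n\<close>,
  the recursion for \<open>h = hyp_coeff C D l\<close>.
\<close>

lemma hypergeometric_equation:
  assumes "C > 0" "D \<ge> 0" "l > 0" "norm z < 1"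
  shows "z * (1 - z) * hyp_d2 C D l z + (C - (D + 1) * z) * hyp_d1 C D l z = l * hyp C D l z"
proof -
  let ?h = "hyp_coeff C D l" and ?F = "hyp C D l z" and ?F1 = "hyp_d1 C D l z" and ?F2 = "hyp_d2 C D l z"
  have F: "(\<lambda>n. ?h n * z ^ n) sums ?F"
    unfolding hyp_def by (rule summable_sums[OF summable_hyp_coeff[OF assms]])
  have F1: "(\<lambda>n. diffs ?h n * z ^ n) sums ?F1"
    unfolding hyp_d1_def by (rule summable_sums[OF summable_diffs_hyp_coeff[OF assms]])
  have shift: "(\<lambda>n. real n * c n * z ^ n) sums (z * S)"
    if "(\<lambda>n. diffs c n * z ^ n) sums S" for c :: "nat \<Rightarrow> real" and S
  proof -
    have "(\<lambda>n. real n * c n * z ^ (n - Suc 0)) sums S"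
      using diffs_equiv[OF sums_summable[OF that]] sums_unique[OF that] by simp
    from sums_mult2[OF this, of z]
    have "(\<lambda>n. real n * c n * z ^ (n - Suc 0) * z) sums (z * S)"
      by (simp add: mult.commute[of S])
    moreover have "real n * c n * z ^ (n - Suc 0) * z = real n * c n * z ^ n" for n
      by (cases n) simp_all
    ultimately show ?thesis by simp
  qed
  have zF1: "(\<lambda>n. real n * ?h n * z ^ n) sums (z * ?F1)"
    by (rule shift[OF F1])
  have "summable (\<lambda>n. diffs (diffs ?h) n * z ^ n)"
    by (rule termdiff_converges[OF assms(4) summable_diffs_hyp_coeff[OF assms(1-3)]])
  then have "(\<lambda>n. diffs (diffs ?h) n * z ^ n) sums ?F2"
    unfolding hyp_d2_def by (rule summable_sums)
  from shift[OF this] have zF2: "(\<lambda>n. real n * diffs ?h n * z ^ n) sums (z * ?F2)" .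
  define f where "f n = (real n - 1) * real n * ?h n * z ^ n" for n
  have "(\<lambda>n. z * (real n * diffs ?h n * z ^ n)) = (\<lambda>n. f (Suc n))"
    by (auto simp: f_def diffs_def simp del: hyp_coeff.simps)
  with sums_mult[OF zF2, of z] have "(\<lambda>n. f (Suc n)) sums (z * (z * ?F2))" by simp
  moreover have "f 0 = 0" by (simp add: f_def)
  ultimately have z2F2: "f sums (z * (z * ?F2))"
    using sums_Suc_iff[of f "z * (z * ?F2)"] by simp
  note sums_diff[OF sums_add[OF sums_diff[OF zF2 z2F2] sums_mult[OF F1, of C]]
      sums_add[OF sums_mult[OF zF1, of "D + 1"] sums_mult[OF F, of l]]]
  moreover have "real n * diffs ?h n * z ^ n - f n + C * (diffs ?h n * z ^ n)
      - ((D + 1) * (real n * ?h n * z ^ n) + l * (?h n * z ^ n)) = 0" for n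
  proof -
    have "(real n + C) * diffs ?h n = (real n * (real n + D) + l) * ?h n"
    proof -
      have cancel: "q * (m * (K / (m * q) * h)) = K * h" if "m > 0" "q > 0" for K m q h :: real
        using that by simp
      show ?thesis
        unfolding diffs_def hyp_coeff.simps of_nat_Suc add.commute[of 1 "real n"]
        using assms(1) by (intro cancel) auto
    qed
    then have "((real n + C) * diffs ?h n - (real n * (real n + D) + l) * ?h n) * z ^ n = 0"
      by simp
    then show ?thesis by (simp add: f_def algebra_simps)
  qed
  ultimately have "(\<lambda>n. 0) sums (z * ?F2 - z * (z * ?F2) + C * ?F1 - ((D + 1) * (z * ?F1) + l * ?F))"
    by simp
  then have "z * ?F2 - z * (z * ?F2) + C * ?F1 - ((D + 1) * (z * ?F1) + l * ?F) = 0"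
    using sums_unique2 sums_zero by blast
  then show ?thesis by (simp add: algebra_simps)
qed

lemma hyp_ge_1:
  assumes "C > 0" "D \<ge> 0" "l > 0" "0 \<le> z" "z < 1"
  shows "hyp C D l z \<ge> 1"
proof -
  have "(\<Sum>n<1. hyp_coeff C D l n * z ^ n) \<le> hyp C D l z"
    unfolding hyp_def using assms hyp_coeff_pos[OF assms(1-3), THEN less_imp_le]
    by (intro sum_le_suminf summable_hyp_coeff) auto
  then show ?thesis by simp
qed

lemma hyp_d1_pos:
  assumes "C > 0" "D \<ge> 0" "l > 0" "0 \<le> z" "z < 1"
  shows "hyp_d1 C D l z > 0"
proof -
  have h: "diffs (hyp_coeff C D l) n > 0" for n
    unfolding diffs_def using hyp_coeff_pos[OF assms(1-3), of "Suc n"]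
    by (intro mult_pos_pos) auto
  have "(\<Sum>n<1. diffs (hyp_coeff C D l) n * z ^ n) \<le> hyp_d1 C D l z"
    unfolding hyp_d1_def using assms h[THEN less_imp_le]
    by (intro sum_le_suminf summable_diffs_hyp_coeff) auto
  with h[of 0] show ?thesis by simp
qed

text \<open>
  The first coefficient is \<open>l / C\<close>, and each later quotient of consecutive coefficients increases with \<open>l\<close>.
\<close>

lemma hyp_coeff_le_linear:
  assumes "C > 0" "D \<ge> 0" "0 < l" "l \<le> 1"
  shows "hyp_coeff C D l (Suc n) \<le> l * hyp_coeff C D 1 (Suc n)"
proof (induction n)
  case (Suc n)
  let ?m = "real (Suc n)"
  have "hyp_coeff C D l (Suc (Suc n)) = (?m * (?m + D) + l) / ((?m + 1) * (?m + C)) * hyp_coeff C D l (Suc n)"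
    by (rule hyp_coeff.simps)
  also have "\<dots> \<le> (?m * (?m + D) + 1) / ((?m + 1) * (?m + C)) * (l * hyp_coeff C D 1 (Suc n))"
    using assms hyp_coeff_pos[OF assms(1-3), of "Suc n"]
    by (intro mult_mono Suc divide_right_mono) (auto simp del: hyp_coeff.simps)
  also have "\<dots> = l * hyp_coeff C D 1 (Suc (Suc n))"
    by (simp only: hyp_coeff.simps(2)[of C D 1 "Suc n"] mult.left_commute)
  finally show ?case .
qed simp

lemma hyp_d1_le_linear:
  assumes "C > 0" "D \<ge> 0" "0 < l" "l \<le> 1" "0 \<le> z" "z < 1"
  shows "hyp_d1 C D l z \<le> l * hyp_d1 C D 1 z"
proof -
  have z: "norm z < 1" using assms by simp
  have "hyp_d1 C D l z \<le> (\<Sum>n. l * (diffs (hyp_coeff C D 1) n * z ^ n))"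
    unfolding hyp_d1_def
  proof (rule suminf_le)
    fix n
    have "diffs (hyp_coeff C D l) n \<le> l * diffs (hyp_coeff C D 1) n"
      unfolding diffs_def
      using mult_left_mono[OF hyp_coeff_le_linear[OF assms(1-4), of n], of "real (Suc n)"]
      by (simp only: mult.left_commute)
    from mult_right_mono[OF this, of "z ^ n"] assms(5)
    show "diffs (hyp_coeff C D l) n * z ^ n \<le> l * (diffs (hyp_coeff C D 1) n * z ^ n)"
      by (simp add: mult.assoc)
  qed (use assms z summable_diffs_hyp_coeff in \<open>auto intro!: summable_mult\<close>)
  also have "\<dots> = l * hyp_d1 C D 1 z"
    unfolding hyp_d1_def using assms z by (intro suminf_mult summable_diffs_hyp_coeff) auto
  finally show ?thesis .
qed

text \<open>
  Near \<open>z = 1\<close> the hypergeometric equation gives \<open>F''/F' \<ge> q/(1 - z)\<close> for every \<open>q < 2a\<close>. If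
  \<open>F'/F \<le> a/(1 - z)\<close> held as well, then \<open>ln (F'/F) + (q - a) ln (1 - z)\<close> would be nondecreasing,
  whereas it is at most \<open>ln a + (q - a - 1) ln (1 - z)\<close>. The latter tends to \<open>-\<infinity>\<close> if
  \<open>q > a + 1\<close>, and such a \<open>q\<close> exists because \<open>a > 1\<close>.
\<close>

lemma hyp_log_derivative_large:
  assumes "C > 0" "l > 0" "a > 1" and D: "D = C + 2 * a - 1" and "z0 < 1"
  shows "\<exists>z\<in>{z0<..<1}. 0 < z \<and> (1 - z) * hyp_d1 C D l z > a * hyp C D l z"
proof (rule ccontr)
  let ?F = "hyp C D l" and ?F1 = "hyp_d1 C D l" and ?F2 = "hyp_d2 C D l"
  have D0: "D \<ge> 0" using assms by simp
  assume no: "\<not> ?thesis"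
  \<comment> \<open>the midpoint of the interval \<open>(a + 1, 2 * a)\<close>\<close>
  define q where "q = (3 * a + 1) / 2"
  have q: "a + 1 < q" "q < 2 * a" using assms by (auto simp: q_def)
  define z1 where "z1 = max (max z0 0) (C / (C + 2 * a - q))"
  have "C / (C + 2 * a - q) < 1" using q assms by simp
  then have z1: "z0 \<le> z1" "0 \<le> z1" "C / (C + 2 * a - q) \<le> z1" "z1 < 1"
    using assms by (auto simp: z1_def)
  have F: "?F z > 0" "?F1 z > 0" if "z1 < z" "z < 1" for z
    using hyp_ge_1[OF assms(1) D0 assms(2), of z] hyp_d1_pos[OF assms(1) D0 assms(2), of z] that z1
    by auto
  have le_a: "(1 - z) * ?F1 z \<le> a * ?F z" if "z1 < z" "z < 1" for z
    using no that z1 by (meson greaterThanLessThan_iff le_less_trans not_le)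
  have ge_q: "(1 - z) * ?F2 z \<ge> q * ?F1 z" if "z1 < z" "z < 1" for z
  proof -
    have "C \<le> (C + 2 * a - q) * z"
      using that z1(3) q assms pos_divide_le_eq[of "C + 2 * a - q" C z]
      by (simp add: mult.commute)
    then have "q * z \<le> (D + 1) * z - C"
      unfolding D by (simp add: algebra_simps)
    then have "(q * z) * ?F1 z \<le> ((D + 1) * z - C) * ?F1 z"
      using F[OF that] by (intro mult_right_mono) auto
    also have "\<dots> \<le> ((D + 1) * z - C) * ?F1 z + l * ?F z"
      using F[OF that] assms by simp
    also have "\<dots> = z * ((1 - z) * ?F2 z)"
      using hypergeometric_equation[OF assms(1) D0 assms(2), of z] that z1
      by (simp add: algebra_simps)
    finally have "z * (q * ?F1 z) \<le> z * ((1 - z) * ?F2 z)"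
      by (simp add: mult_ac)
    then show ?thesis using that z1 by simp
  qed
  define T where "T z = ln (?F1 z) - ln (?F z) + (q - a) * ln (1 - z)" for z
  have dT: "\<exists>t. (T has_real_derivative t) (at z) \<and> 0 \<le> t" if "z1 < z" "z < 1" for z
  proof -
    have nz: "norm z < 1" using that z1 by simp
    have "(T has_real_derivative ?F2 z / ?F1 z - ?F1 z / ?F z + (q - a) * (- 1 / (1 - z))) (at z)"
      unfolding T_def using F[OF that] that
      by (auto intro!: derivative_eq_intros hyp_has_derivative[OF assms(1) D0 assms(2) nz]
          hyp_d1_has_derivative[OF assms(1) D0 assms(2) nz])
    moreover have "?F2 z / ?F1 z \<ge> q / (1 - z)"
      using ge_q[OF that] F[OF that] that by (simp add: field_simps)
    moreover have "?F1 z / ?F z \<le> a / (1 - z)"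
      using le_a[OF that] F[OF that] that by (simp add: field_simps)
    moreover have "q / (1 - z) - a / (1 - z) + (q - a) * (- 1 / (1 - z)) = 0"
      by (simp add: diff_divide_distrib[symmetric])
    ultimately show ?thesis by (intro exI conjI) (assumption, linarith)
  qed
  define z2 where "z2 = (z1 + 1) / 2"
  have z2: "z1 < z2" "z2 < 1" using z1 by (auto simp: z2_def)
  \<comment> \<open>so close to \<open>1\<close> that the upper bound for \<open>T z\<close> is at most \<open>T z2 - 1\<close>\<close>
  define z where "z = 1 - min (1 - z2) (exp ((T z2 - ln a - 1) / (q - a - 1)))"
  have z: "z2 \<le> z" "z < 1" using z2 by (auto simp: z_def)
  then have z1z: "z1 < z" using z2 by simp
  have "T z2 \<le> T z"
    by (rule DERIV_nonneg_imp_nondecreasing[OF z(1)], rule dT) (use z z2 in linarith)+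
  also have "\<dots> \<le> ln a + (q - a - 1) * ln (1 - z)"
  proof -
    have "ln ((1 - z) * ?F1 z) \<le> ln (a * ?F z)"
      using le_a[OF z1z z(2)] F[OF z1z z(2)] z assms(3) by simp
    moreover have "ln ((1 - z) * ?F1 z) = ln (1 - z) + ln (?F1 z)" "ln (a * ?F z) = ln a + ln (?F z)"
      using F[OF z1z z(2)] z assms(3) by (simp_all add: ln_mult)
    ultimately show ?thesis by (simp add: T_def left_diff_distrib)
  qed
  also have "\<dots> \<le> ln a + (T z2 - ln a - 1)"
  proof -
    have "ln (1 - z) \<le> ln (exp ((T z2 - ln a - 1) / (q - a - 1)))"
      using z by (subst ln_le_cancel_iff) (auto simp: z_def)
    then have "ln (1 - z) \<le> (T z2 - ln a - 1) / (q - a - 1)" by simp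
    then have "(q - a - 1) * ln (1 - z) \<le> T z2 - ln a - 1"
      using q by (simp add: pos_le_divide_eq mult.commute)
    then show ?thesis by simp
  qed
  finally show False by simp
qed

section \<open>Upper solutions from the hypergeometric series\<close>

text \<open>
  This is \<open>z (1 - z) w' / w\<close> for \<open>w = z\<^sup>b (1 - z)\<^sup>a F\<close> with \<open>F\<close> hypergeometric. The parameters \<open>2b\<close> and
  \<open>2a + 2b - 1\<close> of \<open>F\<close> are those for which \<open>w\<close> solves an equation
  \<open>z\<^sup>2 (1 - z)\<^sup>2 w'' = q w\<close> with a polynomial \<open>q\<close> of degree at most two.
\<close>

definition hyp_log_deriv :: "real \<Rightarrow> real \<Rightarrow> real \<Rightarrow> real \<Rightarrow> real" where
  "hyp_log_deriv a b l z = b * (1 - z) - a * z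
     + z * (1 - z) * (hyp_d1 (2*b) (2*a + 2*b - 1) l z / hyp (2*b) (2*a + 2*b - 1) l z)"

text \<open>
  With \<open>f = F'/F\<close> and \<open>g = F''/F\<close> one has \<open>f' = g - f\<^sup>2\<close>, and the hypergeometric equation eliminates
  \<open>g\<close>; what remains is an identity of polynomials in \<open>a, b, l, z, f\<close>.
\<close>

lemma hyp_log_deriv_riccati:
  assumes "a > 1" "b \<ge> 1" "l > 0" and z: "0 < z" "z < 1"
  defines "p \<equiv> hyp_log_deriv a b l"
  shows "(p has_real_derivative
     (b * (b - 1) * (1 - z) + a * (a - 1) * z + (l - (a + b) * (a + b - 1)) * (z * (1 - z))
       + (1 - 2 * z) * p z - (p z)\<^sup>2) / (z * (1 - z))) (at z)"
proof -
  define C where "C = 2 * b"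
  define D where "D = 2 * a + 2 * b - 1"
  have CD: "C > 0" "D \<ge> 0" using assms by (auto simp: C_def D_def)
  have nz: "norm z < 1" using z by simp
  have F: "hyp C D l z > 0" using hyp_ge_1[OF CD assms(3), of z] z by simp
  define f where "f = hyp_d1 C D l z / hyp C D l z"
  define g where "g = hyp_d2 C D l z / hyp C D l z"
  have "z * (1 - z) * g + (C - (D + 1) * z) * f
      = (z * (1 - z) * hyp_d2 C D l z + (C - (D + 1) * z) * hyp_d1 C D l z) / hyp C D l z"
    by (simp add: f_def g_def add_divide_distrib)
  also have "\<dots> = l"
    using F by (simp add: hypergeometric_equation[OF CD assms(3) nz])
  finally have eq: "z * (1 - z) * g + (2 * b - (2 * a + 2 * b) * z) * f = l"
    by (simp add: C_def D_def)
  have p: "p = (\<lambda>z. b * (1 - z) - a * z + z * (1 - z) * (hyp_d1 C D l z / hyp C D l z))"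
    by (auto simp: p_def hyp_log_deriv_def C_def D_def)
  have df: "((\<lambda>z. hyp_d1 C D l z / hyp C D l z) has_real_derivative g - f * f) (at z)"
    by (rule DERIV_cong[OF DERIV_divide[OF hyp_d1_has_derivative[OF CD assms(3) nz]
          hyp_has_derivative[OF CD assms(3) nz]]])
      (use F in \<open>simp_all add: f_def g_def field_simps\<close>)
  have dp: "(p has_real_derivative - (a + b) + (1 - 2 * z) * f + z * (1 - z) * (g - f * f)) (at z)"
    unfolding p
    by (rule derivative_eq_intros df refl)+ (simp add: f_def algebra_simps)
  have pz: "p z = b * (1 - z) - a * z + z * (1 - z) * f"
    by (simp add: p f_def)
  have "(- (a + b) + (1 - 2 * z) * f + z * (1 - z) * (g - f * f)) * (z * (1 - z))
      = b * (b - 1) * (1 - z) + a * (a - 1) * z + (l - (a + b) * (a + b - 1)) * (z * (1 - z))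
       + (1 - 2 * z) * p z - (p z)\<^sup>2"
    unfolding pz eq[symmetric] by algebra
  then have "- (a + b) + (1 - 2 * z) * f + z * (1 - z) * (g - f * f)
      = (b * (b - 1) * (1 - z) + a * (a - 1) * z + (l - (a + b) * (a + b - 1)) * (z * (1 - z))
       + (1 - 2 * z) * p z - (p z)\<^sup>2) / (z * (1 - z))"
    using z by (simp add: eq_divide_eq)
  with dp show ?thesis by simp
qed

text \<open>
  For \<open>x = 2z - 1\<close> the operator \<open>(1 - x\<^sup>2) d/dx\<close> is \<open>2z(1 - z) d/dz\<close>, so \<open>U = 4\<nu> p\<close> turns the equation
  for \<open>U\<close> into \<open>8\<nu>\<^sup>2\<close> times the Riccati equation for \<open>p = hyp_log_deriv a b l\<close>.
\<close>

lemma ode_solution_hyp: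
  fixes \<nu> a b l :: real
  assumes "\<nu> > 0" "a > 1" "b \<ge> 1" "l > 0"
    and c: "c$1 = 4 * \<nu>\<^sup>2 * (b * (b - 1))" "c$2 = 4 * \<nu>\<^sup>2 * (a * (a - 1))"
      "c$3 = 2 * \<nu>\<^sup>2 * (l - (a + b) * (a + b - 1))"
  shows "ode_solution \<nu> c (\<lambda>x. 4 * \<nu> * hyp_log_deriv a b l ((1 + x) / 2))"
  unfolding ode_solution_iff[OF assms(1)]
proof
  fix x :: real assume x: "x \<in> {-1<..<1}"
  define z where "z = (1 + x) / 2"
  have z: "0 < z" "z < 1" using x by (auto simp: z_def)
  define p where "p = hyp_log_deriv a b l"
  define R where "R = b * (b - 1) * (1 - z) + a * (a - 1) * z + (l - (a + b) * (a + b - 1)) * (z * (1 - z))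
       + (1 - 2 * z) * p z - (p z)\<^sup>2"
  have "(p has_real_derivative R / (z * (1 - z))) (at z)"
    using hyp_log_deriv_riccati[OF assms(2-4) z] by (simp add: p_def R_def)
  then have dp: "(p has_real_derivative R / (z * (1 - z))) (at ((1 + x) / 2))"
    by (simp add: z_def)
  have "((\<lambda>x. (1 + x) / 2) has_real_derivative 1 / 2) (at x)"
    by (auto intro!: derivative_eq_intros)
  from DERIV_chain2[OF dp this]
  have "((\<lambda>x. p ((1 + x) / 2)) has_real_derivative R / (z * (1 - z)) * (1 / 2)) (at x)" .
  from DERIV_cmult[OF this, of "4 * \<nu>"]
  have d: "((\<lambda>x. 4 * \<nu> * p ((1 + x) / 2)) has_real_derivative 4 * \<nu> * (R / (z * (1 - z)) * (1 / 2))) (at x)" .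
  have x2: "1 - x\<^sup>2 = 4 * (z * (1 - z))" "x = 2 * z - 1"
    by (simp_all add: z_def power2_eq_square field_simps)
  have "Pc c x - 2 * \<nu> * x * (4 * \<nu> * p z) - (4 * \<nu> * p z)\<^sup>2 / 2 = 8 * \<nu>\<^sup>2 * R"
    unfolding Pc_def c x2(1) unfolding x2(2) R_def by (simp add: power2_eq_square algebra_simps)
  moreover have "8 * \<nu>\<^sup>2 * R / (\<nu> * (4 * (z * (1 - z)))) = 4 * \<nu> * (R / (z * (1 - z)) * (1 / 2))"
    using assms(1) z by (simp add: power2_eq_square)
  ultimately have "4 * \<nu> * (R / (z * (1 - z)) * (1 / 2))
     = (Pc c x - 2 * \<nu> * x * (4 * \<nu> * p z) - (4 * \<nu> * p z)\<^sup>2 / 2) / (\<nu> * (1 - x\<^sup>2))"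
    by (simp only: x2(1))
  with d show "((\<lambda>x. 4 * \<nu> * hyp_log_deriv a b l ((1 + x) / 2)) has_real_derivative
      (Pc c x - 2 * \<nu> * x * (4 * \<nu> * hyp_log_deriv a b l ((1 + x) / 2))
        - (4 * \<nu> * hyp_log_deriv a b l ((1 + x) / 2))\<^sup>2 / 2) / (\<nu> * (1 - x\<^sup>2))) (at x)"
    by (simp add: p_def z_def)
qed

text \<open>
  As \<open>z\<close> tends to \<open>0\<close>, \<open>U\<close> tends to \<open>4\<nu>b \<ge> 4\<nu>\<close>, whereas \<open>-2\<nu>x\<close> stays below \<open>2\<nu>\<close>.
\<close>

lemma upper_solution_hyp:
  fixes \<nu> a b l :: real
  assumes "\<nu> > 0" "a > 1" "b \<ge> 1" "l > 0"
    and c: "c$1 = 4 * \<nu>\<^sup>2 * (b * (b - 1))" "c$2 = 4 * \<nu>\<^sup>2 * (a * (a - 1))"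
      "c$3 = 2 * \<nu>\<^sup>2 * (l - (a + b) * (a + b - 1))"
  shows "upper_solution \<nu> c (\<lambda>x. 4 * \<nu> * hyp_log_deriv a b l ((1 + x) / 2))"
proof (rule upper_solutionI[where y = "1 / (a + b) - 1"])
  show "ode_solution \<nu> c (\<lambda>x. 4 * \<nu> * hyp_log_deriv a b l ((1 + x) / 2))"
    using assms by (rule ode_solution_hyp)
  show "1 / (a + b) - 1 > - 1" using assms by simp
  fix x :: real assume x: "- 1 < x" "x \<le> 1 / (a + b) - 1"
  define z where "z = (1 + x) / 2"
  have "1 / (a + b) < 1" using assms by simp
  then have z: "0 < z" "z < 1" "2 * z \<le> 1 / (a + b)" using x by (auto simp: z_def)
  define C where "C = 2 * b"
  define D where "D = 2 * a + 2 * b - 1"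
  have CD: "C > 0" "D \<ge> 0" using assms by (auto simp: C_def D_def)
  have "hyp_d1 C D l z / hyp C D l z \<ge> 0"
    using hyp_ge_1[OF CD assms(4), of z] hyp_d1_pos[OF CD assms(4), of z] z by simp
  then have "z * (1 - z) * (hyp_d1 C D l z / hyp C D l z) \<ge> 0"
    using z by (intro mult_nonneg_nonneg) auto
  then have "hyp_log_deriv a b l z \<ge> b * (1 - z) - a * z"
    by (simp add: hyp_log_deriv_def C_def D_def)
  moreover have "2 * z * (a + b) \<le> 1"
    using z assms by (simp add: pos_le_divide_eq)
  then have "b * (1 - z) - a * z \<ge> b - 1/2" by (simp add: algebra_simps)
  ultimately have "hyp_log_deriv a b l z \<ge> 1/2" using assms by linarith
  then have "4 * \<nu> * hyp_log_deriv a b l z \<ge> 4 * \<nu> * (1 / 2)"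
    using assms by (intro mult_left_mono) auto
  moreover have "- 2 * \<nu> * x \<le> 4 * \<nu> * (1/2)"
    using x assms(1) mult_left_mono[of "-x" 1 "2 * \<nu>"] by simp
  ultimately show "- 2 * \<nu> * x \<le> 4 * \<nu> * hyp_log_deriv a b l ((1 + x) / 2)"
    by (simp add: z_def)
qed fact

text \<open>
  At a point \<open>z0\<close> close to \<open>1\<close> the affine part \<open>b(1 - z) - az\<close> is negative, and for small \<open>l\<close> the
  contribution of \<open>F'/F\<close> is at most half as large. Closer to \<open>1\<close> that contribution exceeds \<open>az\<close>.
  The intermediate value theorem gives a zero in between.
\<close>

lemma exists_upper_solution_with_zero:
  fixes \<nu> c1 c2 \<delta> :: real
  assumes nu: "\<nu> > 0" and c12: "c1 \<ge> 0" "c2 > 0" and d: "\<delta> > 0"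
  shows "\<exists>c U y. c$1 = c1 \<and> c$2 = c2 \<and> c3_bar c1 c2 \<nu> \<le> c$3 \<and> c$3 \<le> c3_bar c1 c2 \<nu> + \<delta>
     \<and> upper_solution \<nu> c U \<and> -1 < y \<and> 1 - \<delta> < y \<and> y < 1 \<and> U y = 0"
proof -
  \<comment> \<open>the positive solutions of \<open>4\<nu>\<^sup>2 a (a - 1) = c2\<close> and \<open>4\<nu>\<^sup>2 b (b - 1) = c1\<close>\<close>
  define a where "a = (1 + sqrt (\<nu>\<^sup>2 + c2) / \<nu>) / 2"
  define b where "b = (1 + sqrt (\<nu>\<^sup>2 + c1) / \<nu>) / 2"
  have sq: "sqrt (\<nu>\<^sup>2 + c1) = \<nu> * (2 * b - 1)" "sqrt (\<nu>\<^sup>2 + c2) = \<nu> * (2 * a - 1)"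
    using nu by (simp_all add: a_def b_def field_simps)
  have "sqrt (\<nu>\<^sup>2) < sqrt (\<nu>\<^sup>2 + c2)" "sqrt (\<nu>\<^sup>2) \<le> sqrt (\<nu>\<^sup>2 + c1)"
    using c12 by (auto simp del: real_sqrt_abs)
  then have a: "a > 1" and b: "b \<ge> 1"
    using nu by (simp_all add: a_def b_def)
  have "\<nu>\<^sup>2 + c1 = (\<nu> * (2 * b - 1))\<^sup>2" "\<nu>\<^sup>2 + c2 = (\<nu> * (2 * a - 1))\<^sup>2"
    unfolding sq[symmetric] using c12 by simp_all
  then have c1: "c1 = 4 * \<nu>\<^sup>2 * (b * (b - 1))" and c2: "c2 = 4 * \<nu>\<^sup>2 * (a * (a - 1))"
    by (simp_all add: power2_eq_square algebra_simps)
  have c3: "c3_bar c1 c2 \<nu> = 2 * \<nu>\<^sup>2 * (- ((a + b) * (a + b - 1)))"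
    unfolding c3_bar_def sq by (simp add: power2_eq_square algebra_simps)
  define C where "C = 2 * b"
  define D where "D = 2 * a + 2 * b - 1"
  have CD: "C > 0" "D \<ge> 0" using a b by (auto simp: C_def D_def)
  \<comment> \<open>The affine part vanishes at \<open>b / (a + b)\<close>; \<open>z0\<close> is at least the midpoint of that point and \<open>1\<close>.\<close>
  define z0 where "z0 = max (1 - \<delta> / 2) ((2 * b + a) / (2 * b + 2 * a))"
  have "(2 * b + a) / (2 * b + 2 * a) > 0" using a b by simp
  moreover have "(2 * b + a) / (2 * b + 2 * a) < 1" using a b by simp
  ultimately have z0: "0 < z0" "z0 < 1" "1 - \<delta> / 2 \<le> z0" "(2 * b + a) / (2 * b + 2 * a) \<le> z0"
    unfolding z0_def using d by auto
  have neg: "b * (1 - z0) - a * z0 < 0"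
  proof -
    have "2 * b + a \<le> z0 * (2 * b + 2 * a)"
      using z0(4) a b by (subst (asm) pos_divide_le_eq) auto
    then show ?thesis using a by (simp add: algebra_simps)
  qed
  define S where "S = z0 * (1 - z0) * hyp_d1 C D 1 z0"
  have S: "S > 0"
    unfolding S_def using z0 hyp_d1_pos[OF CD zero_less_one, of z0] by simp
  \<comment> \<open>The three bounds serve the linear estimate of \<open>F'\<close>, the size of \<open>c$3\<close>, and the sign of \<open>p z0\<close>.\<close>
  define l where "l = min 1 (min (\<delta> / (2 * \<nu>\<^sup>2)) ((a * z0 - b * (1 - z0)) / (2 * S)))"
  have l: "l > 0" "l \<le> 1" "l \<le> \<delta> / (2 * \<nu>\<^sup>2)" "l \<le> (a * z0 - b * (1 - z0)) / (2 * S)"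
    using nu d S neg by (auto simp: l_def)
  define p where "p = hyp_log_deriv a b l"
  have "p z0 < 0"
  proof -
    let ?F = "hyp C D l z0" and ?F1 = "hyp_d1 C D l z0"
    have F: "?F \<ge> 1" "?F1 > 0"
      using hyp_ge_1[OF CD l(1), of z0] hyp_d1_pos[OF CD l(1), of z0] z0 by auto
    then have "?F1 / ?F \<le> ?F1" by (simp add: divide_le_eq)
    also have "\<dots> \<le> l * hyp_d1 C D 1 z0"
      using hyp_d1_le_linear[OF CD l(1,2), of z0] z0 by simp
    finally have "z0 * (1 - z0) * (?F1 / ?F) \<le> z0 * (1 - z0) * (l * hyp_d1 C D 1 z0)"
      using z0 by (intro mult_left_mono) auto
    also have "\<dots> = l * S" by (simp add: S_def)
    also have "\<dots> \<le> (a * z0 - b * (1 - z0)) / 2"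
      using l(4) S by (simp add: pos_le_divide_eq)
    finally have "p z0 \<le> b * (1 - z0) - a * z0 + (a * z0 - b * (1 - z0)) / 2"
      by (simp add: p_def hyp_log_deriv_def C_def D_def)
    moreover have "u - v + (v - u) / 2 < 0" if "u - v < 0" for u v :: real
      using that by (simp add: field_simps)
    from this[OF neg] have "b * (1 - z0) - a * z0 + (a * z0 - b * (1 - z0)) / 2 < 0" .
    ultimately show ?thesis by (rule le_less_trans)
  qed
  moreover obtain z1 where z1: "z0 < z1" "z1 < 1" "p z1 > 0"
  proof -
    have "D = C + 2 * a - 1" by (simp add: C_def D_def)
    from hyp_log_derivative_large[OF CD(1) l(1) a this z0(2)]
    obtain z where z: "z0 < z" "z < 1" "(1 - z) * hyp_d1 C D l z > a * hyp C D l z" by auto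
    have "hyp C D l z > 0" using hyp_ge_1[OF CD l(1), of z] z z0 by simp
    then have "(1 - z) * (hyp_d1 C D l z / hyp C D l z) > a"
      using z by (simp add: field_simps)
    then have "z * ((1 - z) * (hyp_d1 C D l z / hyp C D l z)) > z * a"
      using z z0 by (intro mult_strict_left_mono) auto
    moreover have "b * (1 - z) > 0" using b z by simp
    ultimately have "p z > 0" by (simp add: p_def hyp_log_deriv_def C_def D_def mult_ac)
    with z that show ?thesis by blast
  qed
  moreover have "continuous_on {z0..z1} p"
  proof (rule DERIV_continuous_on)
    fix z assume "z \<in> {z0..z1}"
    then have "0 < z" "z < 1" using z0 z1 by auto
    from hyp_log_deriv_riccati[OF a b l(1) this]
    show "(p has_real_derivative (b * (b - 1) * (1 - z) + a * (a - 1) * z + (l - (a + b) * (a + b - 1)) * (z * (1 - z))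
       + (1 - 2 * z) * p z - (p z)\<^sup>2) / (z * (1 - z))) (at z within {z0..z1})"
      unfolding p_def by (rule has_field_derivative_at_within)
  qed
  ultimately obtain z where z: "z0 \<le> z" "z \<le> z1" "p z = 0"
    using IVT'[of p z0 0 z1] by auto
  define c :: "real^3" where "c = vector [c1, c2, 2 * \<nu>\<^sup>2 * (l - (a + b) * (a + b - 1))]"
  have c: "c$1 = c1" "c$2 = c2" "c$3 = c3_bar c1 c2 \<nu> + 2 * \<nu>\<^sup>2 * l"
    by (simp_all add: c_def c3 right_diff_distrib)
  have "upper_solution \<nu> c (\<lambda>x. 4 * \<nu> * p ((1 + x) / 2))"
    unfolding p_def using nu a b l(1) c1 c2 by (intro upper_solution_hyp) (simp_all add: c_def)
  moreover have "2 * \<nu>\<^sup>2 * l \<le> \<delta>"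
    using l(3) nu by (simp add: pos_le_divide_eq mult_ac)
  moreover have "2 * \<nu>\<^sup>2 * l \<ge> 0" using l nu by simp
  moreover have "4 * \<nu> * p ((1 + (2 * z - 1)) / 2) = 0" using z(3) by simp
  moreover have "-1 < 2 * z - 1" "2 * z - 1 < 1"
    using z z0 z1 by auto
  moreover have "z \<noteq> z0" using \<open>p z0 < 0\<close> z by auto
  then have "1 - \<delta> < 2 * z - 1" using z z0 by simp
  ultimately show ?thesis using c
    by (intro exI[of _ c] exI[of _ "\<lambda>x. 4 * \<nu> * p ((1 + x) / 2)"] exI[of _ "2 * z - 1"]) auto
qed

section \<open>The boundary layer\<close>

text \<open>
  The residual is bounded below at points of the interval rather than in norm, so that the bound
  can be reflected to the other endpoint. For large \<open>k\<close> the point is the zero of \<open>U k\<close>, where the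
  residual is \<open>-P\<close> and \<open>P\<close> tends to \<open>2 c$2\<close>; this gives the uniform bound \<open>c$2\<close>. The
  remaining finitely many \<open>k\<close> contribute positive constants.
\<close>

lemma exists_upper_solutions_with_boundary_layer:
  assumes c: "c$1 \<ge> 0" "c$2 > 0" "c$3 = c3_star (c$1) (c$2)"
  shows "\<exists>(\<nu>::nat \<Rightarrow> real) (ck::nat \<Rightarrow> real^3) U.
     (\<forall>k. \<nu> k > 0) \<and> \<nu> \<longlonglongrightarrow> 0 \<and> (\<forall>k. ck k \<in> Jset (\<nu> k)) \<and> ck \<longlonglongrightarrow> c \<and>
     (\<forall>k. upper_solution (\<nu> k) (ck k) (U k)) \<and>
     (\<forall>\<epsilon>>0. \<exists>m>0. \<forall>k. \<exists>x\<in>{1-\<epsilon><..<1} \<inter> {-1<..<1}. m \<le> \<bar>1/2 * (U k x)\<^sup>2 - Pc (ck k) x\<bar>)"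
proof -
  define \<nu> where "\<nu> k = 1 / real (Suc k)" for k
  have nu: "\<nu> k > 0" for k by (simp add: \<nu>_def)
  have nu0: "\<nu> \<longlonglongrightarrow> 0" unfolding \<nu>_def by (rule LIMSEQ_Suc[OF lim_1_over_n])
  have "\<forall>k. \<exists>d U y. d$1 = c$1 \<and> d$2 = c$2 \<and> c3_bar (c$1) (c$2) (\<nu> k) \<le> d$3
     \<and> d$3 \<le> c3_bar (c$1) (c$2) (\<nu> k) + \<nu> k
     \<and> upper_solution (\<nu> k) d U \<and> -1 < y \<and> 1 - \<nu> k < y \<and> y < 1 \<and> U y = 0"
    using exists_upper_solution_with_zero[OF nu c(1,2) nu] by blast
  then obtain ck :: "nat \<Rightarrow> real^3" and U :: "nat \<Rightarrow> real \<Rightarrow> real" and y where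
    ck: "\<And>k. ck k $ 1 = c$1" "\<And>k. ck k $ 2 = c$2"
      "\<And>k. c3_bar (c$1) (c$2) (\<nu> k) \<le> ck k $ 3" "\<And>k. ck k $ 3 \<le> c3_bar (c$1) (c$2) (\<nu> k) + \<nu> k"
    and U: "\<And>k. upper_solution (\<nu> k) (ck k) (U k)"
    and y: "\<And>k. -1 < y k" "\<And>k. 1 - \<nu> k < y k" "\<And>k. y k < 1" "\<And>k. U k (y k) = 0"
    by metis
  have Jset: "ck k \<in> Jset (\<nu> k)" for k
  proof -
    have "- (\<nu> k)\<^sup>2 \<le> 0" by simp
    then have "- (\<nu> k)\<^sup>2 \<le> c$1" "- (\<nu> k)\<^sup>2 \<le> c$2" using c(1,2) by linarith+
    with ck show ?thesis by (simp add: Jset_def)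
  qed
  have "(\<lambda>k. c3_bar (c$1) (c$2) (\<nu> k)) \<longlonglongrightarrow> c3_bar (c$1) (c$2) 0"
    unfolding c3_bar_def by (intro tendsto_intros nu0)
  then have bar: "(\<lambda>k. c3_bar (c$1) (c$2) (\<nu> k)) \<longlonglongrightarrow> c$3"
    by (simp add: c(3) c3_star_def)
  have bar': "(\<lambda>k. c3_bar (c$1) (c$2) (\<nu> k) + \<nu> k) \<longlonglongrightarrow> c$3"
    using tendsto_add[OF bar nu0] by simp
  have ck3: "(\<lambda>k. ck k $ 3) \<longlonglongrightarrow> c$3"
    by (rule real_tendsto_sandwich[OF _ _ bar bar']) (simp_all add: ck)
  have "ck \<longlonglongrightarrow> c"
  proof (rule vec_tendstoI)
    fix i :: 3
    show "(\<lambda>k. ck k $ i) \<longlonglongrightarrow> c $ i"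
      using exhaust_3[of i] ck ck3 by auto
  qed
  have "(\<lambda>k. 1 - \<nu> k) \<longlonglongrightarrow> 1" using tendsto_diff[OF tendsto_const nu0] by simp
  from real_tendsto_sandwich[OF _ _ this tendsto_const] have y1: "y \<longlonglongrightarrow> 1"
    by (simp add: y less_imp_le)
  have "(\<lambda>k. Pc (ck k) (y k)) \<longlonglongrightarrow> c$1 * (1 - 1) + c$2 * (1 + 1) + c$3 * (1 - 1\<^sup>2)"
    unfolding Pc_def ck by (intro tendsto_intros y1 ck3)
  then have Plim: "(\<lambda>k. Pc (ck k) (y k)) \<longlonglongrightarrow> 2 * c$2" by (simp add: mult.commute)
  have "\<exists>m>0. \<forall>k. \<exists>x\<in>{1-\<epsilon><..<1} \<inter> {-1<..<1}. m \<le> \<bar>1/2 * (U k x)\<^sup>2 - Pc (ck k) x\<bar>"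
    if eps: "\<epsilon> > 0" for \<epsilon>
  proof -
    have "\<forall>\<^sub>F k in sequentially. c$2 < Pc (ck k) (y k) \<and> 1 - \<epsilon> < y k"
      using c(2) eps order_tendstoD(1)[OF Plim, of "c$2"] order_tendstoD(1)[OF y1, of "1 - \<epsilon>"]
      by (simp add: eventually_conj_iff)
    then obtain N where N: "\<And>k. k \<ge> N \<Longrightarrow> c$2 < Pc (ck k) (y k)" "\<And>k. k \<ge> N \<Longrightarrow> 1 - \<epsilon> < y k"
      by (auto simp: eventually_sequentially)
    have "\<forall>k. \<exists>x\<in>{1-\<epsilon><..<1} \<inter> {-1<..<1}. 1/2 * (U k x)\<^sup>2 - Pc (ck k) x \<noteq> 0"
      using U c(2) eps ck(2)
      by (intro allI ode_solution_residual_nonzero[OF nu]) (auto simp: upper_solution_def)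
    then obtain x where x: "\<And>k. x k \<in> {1-\<epsilon><..<1} \<inter> {-1<..<1}"
      "\<And>k. 1/2 * (U k (x k))\<^sup>2 - Pc (ck k) (x k) \<noteq> 0"
      by metis
    define r where "r k = \<bar>1/2 * (U k (x k))\<^sup>2 - Pc (ck k) (x k)\<bar>" for k
    define m where "m = Min (insert (c$2) (r ` {..<N}))"
    have "m > 0" unfolding m_def using c(2) x(2) by (auto simp: r_def)
    moreover have "\<exists>x\<in>{1-\<epsilon><..<1} \<inter> {-1<..<1}. m \<le> \<bar>1/2 * (U k x)\<^sup>2 - Pc (ck k) x\<bar>" for k
    proof (cases "k < N")
      case True
      then have "m \<le> r k" unfolding m_def by (intro Min_le) auto
      with x(1)[of k] show ?thesis unfolding r_def by blast
    next
      case False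
      have "m \<le> c$2" unfolding m_def by (intro Min_le) auto
      with False N(1)[of k] have "m \<le> \<bar>1/2 * (U k (y k))\<^sup>2 - Pc (ck k) (y k)\<bar>"
        by (simp add: y(4))
      moreover have "y k \<in> {1-\<epsilon><..<1} \<inter> {-1<..<1}" using y N(2)[of k] False by simp
      ultimately show ?thesis by blast
    qed
    ultimately show ?thesis by blast
  qed
  then show ?thesis
    by (intro exI[of _ \<nu>] exI[of _ ck] exI[of _ U] conjI allI impI nu nu0 Jset \<open>ck \<longlonglongrightarrow> c\<close> U)
qed

lemma Jset_swap12: "swap12 c \<in> Jset \<nu> \<longleftrightarrow> c \<in> Jset \<nu>"
  by (auto simp: Jset_def c3_bar_def add.commute)

lemma frontier_Jset_0_nonneg:
  assumes "c \<in> frontier (Jset 0)"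
  shows "c$1 \<ge> 0" "c$2 \<ge> 0"
proof -
  have "closed ({c::real^3. c$1 \<ge> 0} \<inter> {c. c$2 \<ge> 0})"
    by (intro closed_Int closed_halfspace_component_ge_cart)
  then have "closure (Jset 0) \<subseteq> {c. c$1 \<ge> 0} \<inter> {c. c$2 \<ge> 0}"
    by (intro closure_minimal) (auto simp: Jset_def)
  with assms show "c$1 \<ge> 0" "c$2 \<ge> 0" by (auto simp: frontier_def)
qed

lemma INF_Linf_norm_residual_pos:
  fixes U :: "nat \<Rightarrow> real \<Rightarrow> real"
  assumes "open S" "m > 0" "\<And>k. continuous_on {-1<..<1} (U k)"
    and x: "\<And>k. \<exists>x\<in>S \<inter> {-1<..<1}. m \<le> \<bar>1/2 * (U k x)\<^sup>2 - Pc (ck k) x\<bar>"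
  shows "(INF k. Linf_norm S (\<lambda>x. (1/2) * (U k x)^2 - Pc (ck k) x)) > 0"
proof -
  have "ereal m \<le> Linf_norm S (\<lambda>x. (1/2) * (U k x)^2 - Pc (ck k) x)" for k
  proof -
    obtain x where "x \<in> S \<inter> {-1<..<1}" "m \<le> \<bar>1/2 * (U k x)\<^sup>2 - Pc (ck k) x\<bar>" using x by blast
    moreover have "continuous_on {-1<..<1} (\<lambda>x. (1/2) * (U k x)^2 - Pc (ck k) x)"
      unfolding Pc_def by (intro continuous_intros assms(3))
    ultimately show ?thesis
      using Linf_norm_ge[OF assms(1), of x "\<lambda>x. (1/2) * (U k x)^2 - Pc (ck k) x"]
      by (meson ereal_less_eq(3) order_trans)
  qed
  then have "ereal m \<le> (INF k. Linf_norm S (\<lambda>x. (1/2) * (U k x)^2 - Pc (ck k) x))"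
    by (intro INF_greatest)
  moreover have "0 < ereal m" using assms(2) by simp
  ultimately show ?thesis by (rule less_le_trans[rotated])
qed

theorem theorem1p5:
  shows "(\<forall>c::real^3. c \<in> frontier (Jset 0) \<and> c$3 = c3_star (c$1) (c$2) \<and> c$2 > 0 \<longrightarrow>
           (\<exists>(\<nu>::nat \<Rightarrow> real) (ck::nat \<Rightarrow> real^3) (U::nat \<Rightarrow> real \<Rightarrow> real).
              (\<forall>k. \<nu> k > 0) \<and> \<nu> \<longlonglongrightarrow> 0 \<and>
              (\<forall>k. ck k \<in> Jset (\<nu> k)) \<and> ck \<longlonglongrightarrow> c \<and>
              (\<forall>k. upper_solution (\<nu> k) (ck k) (U k)) \<and>
              (\<forall>\<epsilon>>0. (INF k. Linf_norm {1-\<epsilon><..<1} (\<lambda>x. (1/2) * (U k x)^2 - Pc (ck k) x)) > 0)))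
       \<and> (\<forall>c::real^3. c \<in> frontier (Jset 0) \<and> c$3 = c3_star (c$1) (c$2) \<and> c$1 > 0 \<longrightarrow>
           (\<exists>(\<nu>::nat \<Rightarrow> real) (ck::nat \<Rightarrow> real^3) (U::nat \<Rightarrow> real \<Rightarrow> real).
              (\<forall>k. \<nu> k > 0) \<and> \<nu> \<longlonglongrightarrow> 0 \<and>
              (\<forall>k. ck k \<in> Jset (\<nu> k)) \<and> ck \<longlonglongrightarrow> c \<and>
              (\<forall>k. lower_solution (\<nu> k) (ck k) (U k)) \<and>
              (\<forall>\<epsilon>>0. (INF k. Linf_norm {-1<..<-1+\<epsilon>} (\<lambda>x. (1/2) * (U k x)^2 - Pc (ck k) x)) > 0)))"
proof (intro conjI allI impI; elim conjE)
  fix c :: "real^3"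
  assume c: "c \<in> frontier (Jset 0)" "c$3 = c3_star (c$1) (c$2)" "c$2 > 0"
  obtain \<nu> :: "nat \<Rightarrow> real" and ck :: "nat \<Rightarrow> real^3" and U where
    seq: "\<forall>k. \<nu> k > 0" "\<nu> \<longlonglongrightarrow> 0" "\<forall>k. ck k \<in> Jset (\<nu> k)" "ck \<longlonglongrightarrow> c"
      "\<forall>k. upper_solution (\<nu> k) (ck k) (U k)"
    and layer: "\<And>\<epsilon>. \<epsilon> > 0 \<Longrightarrow> \<exists>m>0. \<forall>k. \<exists>x\<in>{1-\<epsilon><..<1} \<inter> {-1<..<1}.
        m \<le> \<bar>1/2 * (U k x)\<^sup>2 - Pc (ck k) x\<bar>"
    using exists_upper_solutions_with_boundary_layer[OF frontier_Jset_0_nonneg(1)[OF c(1)] c(3,2)]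
    by blast
  have cont: "continuous_on {-1<..<1} (U k)" for k
    using seq(5) ode_solution_continuous_on unfolding upper_solution_def by blast
  have "\<forall>\<epsilon>>0. (INF k. Linf_norm {1-\<epsilon><..<1} (\<lambda>x. (1/2) * (U k x)^2 - Pc (ck k) x)) > 0"
  proof (intro allI impI)
    fix \<epsilon> :: real assume "\<epsilon> > 0"
    then obtain m where "m > 0" "\<And>k. \<exists>x\<in>{1-\<epsilon><..<1} \<inter> {-1<..<1}.
        m \<le> \<bar>1/2 * (U k x)\<^sup>2 - Pc (ck k) x\<bar>" using layer by blast
    then show "(INF k. Linf_norm {1-\<epsilon><..<1} (\<lambda>x. (1/2) * (U k x)^2 - Pc (ck k) x)) > 0"
      using cont by (intro INF_Linf_norm_residual_pos) auto
  qed
  with seq show "\<exists>(\<nu>::nat \<Rightarrow> real) (ck::nat \<Rightarrow> real^3) (U::nat \<Rightarrow> real \<Rightarrow> real).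
              (\<forall>k. \<nu> k > 0) \<and> \<nu> \<longlonglongrightarrow> 0 \<and>
              (\<forall>k. ck k \<in> Jset (\<nu> k)) \<and> ck \<longlonglongrightarrow> c \<and>
              (\<forall>k. upper_solution (\<nu> k) (ck k) (U k)) \<and>
              (\<forall>\<epsilon>>0. (INF k. Linf_norm {1-\<epsilon><..<1} (\<lambda>x. (1/2) * (U k x)^2 - Pc (ck k) x)) > 0)"
    by (intro exI[of _ \<nu>] exI[of _ ck] exI[of _ U] conjI) assumption+
next
  fix c :: "real^3"
  assume c: "c \<in> frontier (Jset 0)" "c$3 = c3_star (c$1) (c$2)" "c$1 > 0"
  have c': "swap12 c $ 1 \<ge> 0" "swap12 c $ 2 > 0" "swap12 c $ 3 = c3_star (swap12 c $ 1) (swap12 c $ 2)"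
    using c frontier_Jset_0_nonneg(2)[OF c(1)] by (simp_all add: c3_star_def c3_bar_def add.commute)
  obtain \<nu> :: "nat \<Rightarrow> real" and dk :: "nat \<Rightarrow> real^3" and V where
    seq: "\<forall>k. \<nu> k > 0" "\<nu> \<longlonglongrightarrow> 0" "\<forall>k. dk k \<in> Jset (\<nu> k)" "dk \<longlonglongrightarrow> swap12 c"
      "\<forall>k. upper_solution (\<nu> k) (dk k) (V k)"
    and layer: "\<And>\<epsilon>. \<epsilon> > 0 \<Longrightarrow> \<exists>m>0. \<forall>k. \<exists>x\<in>{1-\<epsilon><..<1} \<inter> {-1<..<1}.
        m \<le> \<bar>1/2 * (V k x)\<^sup>2 - Pc (dk k) x\<bar>"
    using exists_upper_solutions_with_boundary_layer[OF c'] by blast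
  define ck where "ck k = swap12 (dk k)" for k
  define U where "U k x = - V k (- x)" for k and x :: real
  have low: "lower_solution (\<nu> k) (ck k) (U k)" for k
    using lower_solution_reflect seq(1,5) unfolding ck_def U_def[abs_def] by blast
  have "ck \<longlonglongrightarrow> c"
  proof (rule vec_tendstoI)
    fix i :: 3
    have "(\<lambda>k. dk k $ j) \<longlonglongrightarrow> swap12 c $ j" for j
      by (rule tendsto_vec_nth[OF seq(4)])
    from this[of 1] this[of 2] this[of 3]
    show "(\<lambda>k. ck k $ i) \<longlonglongrightarrow> c $ i"
      using exhaust_3[of i] by (auto simp: ck_def)
  qed
  have cont: "continuous_on {-1<..<1} (U k)" for k
    using low ode_solution_continuous_on unfolding lower_solution_def by blast
  have "\<forall>\<epsilon>>0. (INF k. Linf_norm {-1<..<-1+\<epsilon>} (\<lambda>x. (1/2) * (U k x)^2 - Pc (ck k) x)) > 0"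
  proof (intro allI impI)
    fix \<epsilon> :: real assume "\<epsilon> > 0"
    then obtain m where m: "m > 0" "\<And>k. \<exists>x\<in>{1-\<epsilon><..<1} \<inter> {-1<..<1}.
        m \<le> \<bar>1/2 * (V k x)\<^sup>2 - Pc (dk k) x\<bar>" using layer by blast
    have "\<exists>x\<in>{-1<..<-1+\<epsilon>} \<inter> {-1<..<1}. m \<le> \<bar>1/2 * (U k x)\<^sup>2 - Pc (ck k) x\<bar>" for k
    proof -
      obtain x where "x \<in> {1-\<epsilon><..<1} \<inter> {-1<..<1}" "m \<le> \<bar>1/2 * (V k x)\<^sup>2 - Pc (dk k) x\<bar>"
        using m(2) by blast
      then show ?thesis
        by (intro bexI[of _ "- x"]) (auto simp: U_def ck_def Pc_swap12)
    qed
    with m(1) cont show "(INF k. Linf_norm {-1<..<-1+\<epsilon>} (\<lambda>x. (1/2) * (U k x)^2 - Pc (ck k) x)) > 0"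
      by (intro INF_Linf_norm_residual_pos) auto
  qed
  moreover have "\<forall>k. ck k \<in> Jset (\<nu> k)" using seq(3) by (simp add: ck_def Jset_swap12)
  moreover have "\<forall>k. lower_solution (\<nu> k) (ck k) (U k)" using low by blast
  moreover note seq(1,2) \<open>ck \<longlonglongrightarrow> c\<close>
  ultimately show "\<exists>(\<nu>::nat \<Rightarrow> real) (ck::nat \<Rightarrow> real^3) (U::nat \<Rightarrow> real \<Rightarrow> real).
              (\<forall>k. \<nu> k > 0) \<and> \<nu> \<longlonglongrightarrow> 0 \<and>
              (\<forall>k. ck k \<in> Jset (\<nu> k)) \<and> ck \<longlonglongrightarrow> c \<and>
              (\<forall>k. lower_solution (\<nu> k) (ck k) (U k)) \<and>
              (\<forall>\<epsilon>>0. (INF k. Linf_norm {-1<..<-1+\<epsilon>} (\<lambda>x. (1/2) * (U k x)^2 - Pc (ck k) x)) > 0)"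
    by (intro exI[of _ \<nu>] exI[of _ ck] exI[of _ U] conjI) assumption+
qed

end
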